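(* Let $G=(V,E)$ be a finite undirected graph with $n$ nodes and $m$ edges, and let $H^{\ast}\subseteq V$ be a densest subgraph, i.e. a nonempty set maximizing $\mathrm{d}(H)=|E(H)|/|H|$ over nonempty $H\subseteq V$. Let $0\le \epsilon<1$, and suppose we are given $S\subseteq V$ such that (1) $|S\cap H^{\ast}|\ge (1-\epsilon)|H^{\ast}|$, and (2) $|S\setminus H^{\ast}|\le \epsilon |H^{\ast}|$. Then there exists an $O(m)$ time algorithm that, given $G$, $S$ and $\epsilon$, finds a subset $T\subseteq V$ with $\mathrm{d}(T)\ge (1-3\epsilon)\,\mathrm{d}(H^{\ast})$.
   Context: For $U\subseteq V$, $E(U)$ denotes the set of edges of $G$ with both endpoints in $U$, and the density of a nonempty $U$ is $\mathrm{d}(U)=|E(U)|/|U|$. *)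

theory Defs
  imports Complex_Main "HOL-Library.Landau_Symbols"
begin

definition graph :: "'a set \<Rightarrow> 'a set set \<Rightarrow> bool" where
  "graph V E \<longleftrightarrow> finite V \<and> (\<forall>e\<in>E. e \<subseteq> V \<and> card e = 2)"

definition edges_within :: "'a set set \<Rightarrow> 'a set \<Rightarrow> 'a set set" where
  "edges_within E U = {e \<in> E. e \<subseteq> U}"

definition density :: "'a set set \<Rightarrow> 'a set \<Rightarrow> real" where
  "density E U = real (card (edges_within E U)) / real (card U)"

definition densest_subgraph :: "'a set \<Rightarrow> 'a set set \<Rightarrow> 'a set \<Rightarrow> bool" where
  "densest_subgraph V E H \<longleftrightarrow>
     H \<subseteq> V \<and> H \<noteq> {} \<and> (\<forall>U. U \<subseteq> V \<and> U \<noteq> {} \<longrightarrow> density E U \<le> density E H)"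

text \<open>
  Running time is measured on a unit-cost random access machine. It has integer registers and
  an addressable memory, both holding natural numbers, and real registers with exact arithmetic,
  since the accuracy parameter of the algorithm is an arbitrary real number. Real registers have
  fixed addresses, and there is no rounding of reals to integers. The size of machine words is
  restricted below.
\<close>

datatype arith = Add | Sub | Mul | Div

datatype instr =
    Const nat nat              \<comment> \<open>\<open>reg[i] := k\<close>\<close>
  | Arith arith nat nat nat    \<comment> \<open>\<open>reg[i] := reg[j] op reg[k]\<close>\<close>
  | Load nat nat               \<comment> \<open>\<open>reg[i] := mem[reg[j]]\<close>\<close>
  | Store nat nat              \<comment> \<open>\<open>mem[reg[i]] := reg[j]\<close>\<close>
  | Jump nat                   \<comment> \<open>\<open>goto l\<close>\<close>
  | JumpLess nat nat nat       \<comment> \<open>\<open>if reg[i] < reg[j] then goto l\<close>\<close>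
  | RealOf nat nat             \<comment> \<open>\<open>rreg[i] := reg[j]\<close>\<close>
  | RArith arith nat nat nat   \<comment> \<open>\<open>rreg[i] := rreg[j] op rreg[k]\<close>\<close>
  | RJumpLess nat nat nat      \<comment> \<open>\<open>if rreg[i] < rreg[j] then goto l\<close>\<close>

type_synonym program = "instr list"

record state =
  pc :: nat
  reg :: "nat \<Rightarrow> nat"
  mem :: "nat \<Rightarrow> nat"
  rreg :: "nat \<Rightarrow> real"

text \<open>On natural numbers \<open>Sub\<close> is truncated and \<open>Div\<close> rounds down; division by zero yields zero.\<close>

fun nat_op :: "arith \<Rightarrow> nat \<Rightarrow> nat \<Rightarrow> nat" where
  "nat_op Add x y = x + y"
| "nat_op Sub x y = x - y"
| "nat_op Mul x y = x * y"
| "nat_op Div x y = x div y"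

fun real_op :: "arith \<Rightarrow> real \<Rightarrow> real \<Rightarrow> real" where
  "real_op Add x y = x + y"
| "real_op Sub x y = x - y"
| "real_op Mul x y = x * y"
| "real_op Div x y = x / y"

fun exec :: "instr \<Rightarrow> state \<Rightarrow> state" where
  "exec (Const i k) s = s\<lparr>pc := pc s + 1, reg := (reg s)(i := k)\<rparr>"
| "exec (Arith f i j k) s =
     s\<lparr>pc := pc s + 1, reg := (reg s)(i := nat_op f (reg s j) (reg s k))\<rparr>"
| "exec (Load i j) s = s\<lparr>pc := pc s + 1, reg := (reg s)(i := mem s (reg s j))\<rparr>"
| "exec (Store i j) s = s\<lparr>pc := pc s + 1, mem := (mem s)(reg s i := reg s j)\<rparr>"
| "exec (Jump l) s = s\<lparr>pc := l\<rparr>"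
| "exec (JumpLess i j l) s = s\<lparr>pc := (if reg s i < reg s j then l else pc s + 1)\<rparr>"
| "exec (RealOf i j) s = s\<lparr>pc := pc s + 1, rreg := (rreg s)(i := real (reg s j))\<rparr>"
| "exec (RArith f i j k) s =
     s\<lparr>pc := pc s + 1, rreg := (rreg s)(i := real_op f (rreg s j) (rreg s k))\<rparr>"
| "exec (RJumpLess i j l) s = s\<lparr>pc := (if rreg s i < rreg s j then l else pc s + 1)\<rparr>"

text \<open>The machine halts as soon as the program counter leaves the program.\<close>

definition halted :: "program \<Rightarrow> state \<Rightarrow> bool" where
  "halted P s \<longleftrightarrow> length P \<le> pc s"

definition step :: "program \<Rightarrow> state \<Rightarrow> state" where
  "step P s = (if halted P s then s else exec (P ! pc s) s)"

definition words_below :: "nat \<Rightarrow> state \<Rightarrow> bool" where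
  "words_below B s \<longleftrightarrow> (\<forall>i. reg s i < B \<and> mem s i < B)"

text \<open>
  \<open>halts_within P B k s s'\<close>: started in \<open>s\<close>, the program halts in \<open>s'\<close> after at most \<open>k\<close> steps, and
  no integer outside \<open>{0..<B}\<close> occurs in the registers or the memory at any time.
\<close>

definition halts_within :: "program \<Rightarrow> nat \<Rightarrow> nat \<Rightarrow> state \<Rightarrow> state \<Rightarrow> bool" where
  "halts_within P B k s s' \<longleftrightarrow>
     (\<exists>j\<le>k. (step P ^^ j) s = s' \<and> halted P s' \<and> (\<forall>i\<le>j. words_below B ((step P ^^ i) s)))"

text \<open>
  A graph on the vertices \<open>{..<n}\<close> is presented by \<open>n\<close> and a list of its edges, in any order and
  with either orientation of each edge; a vertex set is presented by a list of its elements.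
\<close>

definition lists_edges :: "(nat \<times> nat) list \<Rightarrow> nat set set \<Rightarrow> bool" where
  "lists_edges es E \<longleftrightarrow>
     (let fs = map (\<lambda>(u, v). {u, v}) es in distinct fs \<and> set fs = E)"

definition lists_set :: "nat list \<Rightarrow> nat set \<Rightarrow> bool" where
  "lists_set vs U \<longleftrightarrow> distinct vs \<and> set vs = U"

definition encode_input :: "nat \<Rightarrow> (nat \<times> nat) list \<Rightarrow> nat list \<Rightarrow> nat list" where
  "encode_input n es vs =
     [n, length es] @ concat (map (\<lambda>(u, v). [u, v]) es) @ [length vs] @ vs"

definition initial_state :: "nat list \<Rightarrow> real \<Rightarrow> state" where
  "initial_state xs x =
     \<lparr>pc = 0, reg = (\<lambda>_. 0), mem = (\<lambda>i. if i < length xs then xs ! i else 0),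
      rreg = (\<lambda>_. 0)(0 := x)\<rparr>"

text \<open>The output is the list of length \<open>reg[1]\<close> stored in memory from address \<open>reg[0]\<close> on.\<close>

definition output_list :: "state \<Rightarrow> nat list" where
  "output_list s = map (\<lambda>i. mem s (reg s 0 + i)) [0..<reg s 1]"

end

theory Submission
  imports Defs
begin

text \<open>
  For a vertex \<open>v\<close> outside \<open>S\<close> let \<open>deg v\<close> be its number of neighbours in \<open>S\<close>. For a set \<open>A\<close> disjoint
  from \<open>S\<close>, the set \<open>S \<union> A\<close> spans at least \<open>w(A) = |E(S)| + (\<Sum>v\<in>A. deg v)\<close> edges, and the quotient
  \<open>w(A) / (|S| + |A|)\<close> is maximal for a set of the form \<open>{v. deg v > \<tau>}\<close>. If \<open>\<lambda>\<close> is the maximum,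
  then \<open>|E(S)| + (\<Sum>v. max 0 (deg v - \<lambda>)) = \<lambda> |S|\<close>, so one may take for \<open>\<tau>\<close> the largest
  integer for which the left-hand side is at least \<open>\<tau> |S|\<close>, and all these values are computed from
  the numbers of vertices with \<open>deg v \<ge> j\<close>. Comparing with \<open>A = H - S\<close>, and using that \<open>H - S\<close> spans at
  most \<open>d(H) |H - S| \<le> \<epsilon> d(H) |H|\<close> edges, gives the ratio \<open>(1 - \<epsilon>) / (1 + \<epsilon>) \<ge> 1 - 3 \<epsilon>\<close>.

  The time is linear in \<open>m\<close> alone since \<open>H\<close> has no isolated vertices if \<open>m > 0\<close>, and therefore
  \<open>|S| \<le> 2 |H| \<le> 4 m\<close>; if \<open>m = 0\<close>, the algorithm returns \<open>{0}\<close> without reading \<open>S\<close>.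
\<close>

subsection \<open>Thresholds on the number of neighbours\<close>

definition cross_degree :: "'a set set \<Rightarrow> 'a set \<Rightarrow> 'a \<Rightarrow> nat" where
  "cross_degree E S v = card {e \<in> E. v \<in> e \<and> e \<inter> S \<noteq> {}}"

lemma graph_finite_edges:
  assumes "graph V E"
  shows "finite E"
  by (rule finite_subset[of _ "Pow V"]) (use assms in \<open>auto simp: graph_def\<close>)

text \<open>Since \<open>A\<close> misses \<open>S\<close> and edges have two endpoints, an edge
  meeting both sets has one endpoint in each. It is thus counted for exactly one \<open>v\<close> in
  \<open>A\<close> and does not lie inside \<open>S\<close>.\<close>

lemma card_edges_touching:
  assumes G: "graph V E" and A: "finite A" "A \<inter> S = {}"
  shows "card {e \<in> E. e \<subseteq> S \<union> A \<and> e \<inter> S \<noteq> {}} =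
    card (edges_within E S) + (\<Sum>v\<in>A. cross_degree E S v)"
proof -
  define F where "F v = {e \<in> E. v \<in> e \<and> e \<inter> S \<noteq> {}}" for v
  have fE: "finite E" by (rule graph_finite_edges[OF G])
  have c2: "card e = 2" if "e \<in> E" for e using G that by (auto simp: graph_def)
  have pair: "e = {v, w}" if "e \<in> E" "v \<in> e" "w \<in> e" "v \<noteq> w" for e v w
  proof -
    have "{v, w} \<subseteq> e" "card {v, w} = card e" using that c2 by auto
    moreover have "finite e" using c2[OF that(1)] by (metis card.infinite zero_neq_numeral)
    ultimately show ?thesis using card_subset_eq by metis
  qed
  have ne: "e \<noteq> {}" if "e \<in> E" for e using c2[OF that] by auto
  have "{e \<in> E. e \<subseteq> S \<union> A \<and> e \<inter> S \<noteq> {}} = edges_within E S \<union> (\<Union>v\<in>A. F v)" (is "?L = ?R")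
  proof (intro equalityI subsetI)
    fix e assume "e \<in> ?L"
    then show "e \<in> ?R" by (auto simp: edges_within_def F_def)
  next
    fix e assume "e \<in> ?R"
    then consider "e \<in> E" "e \<subseteq> S" | v w where "e \<in> E" "v \<in> A" "v \<in> e" "w \<in> e" "w \<in> S"
      by (auto simp: edges_within_def F_def)
    then show "e \<in> ?L"
    proof cases
      case 1
      then show ?thesis using ne by auto
    next
      case 2
      then have "v \<noteq> w" using A by auto
      then have "e = {v, w}" using pair 2 by blast
      then show ?thesis using 2 by auto
    qed
  qed
  moreover have "card (edges_within E S \<union> (\<Union>v\<in>A. F v)) =
      card (edges_within E S) + card (\<Union>v\<in>A. F v)"
    by (rule card_Un_disjoint)
      (use fE A in \<open>auto simp: edges_within_def F_def\<close>)
  moreover have "card (\<Union>v\<in>A. F v) = (\<Sum>v\<in>A. card (F v))"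
  proof (rule card_UN_disjoint)
    show "\<forall>i\<in>A. \<forall>j\<in>A. i \<noteq> j \<longrightarrow> F i \<inter> F j = {}"
    proof (intro ballI impI equals0I)
      fix i j e assume "i \<in> A" "j \<in> A" "i \<noteq> j" "e \<in> F i \<inter> F j"
      moreover from this have "e = {i, j}" using pair by (auto simp: F_def)
      ultimately show False using A by (auto simp: F_def)
    qed
  qed (use fE A in \<open>auto simp: F_def\<close>)
  ultimately show ?thesis by (simp add: cross_degree_def F_def)
qed

text \<open>Layer-cake argument: split \<open>f v\<close> into \<open>min (f v) k\<close> and the
  excess over \<open>k\<close>, and count the first part level by level.\<close>

lemma sum_diff_layers:
  fixes f :: "'a \<Rightarrow> nat"
  assumes "finite V"
  shows "(\<Sum>v\<in>V. f v) = (\<Sum>j<k. card {v \<in> V. j < f v}) + (\<Sum>v\<in>V. f v - k)"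
proof (induction k)
  case (Suc k)
  have "(\<Sum>v\<in>V. f v - k) = (\<Sum>v\<in>V. (if k < f v then 1 else 0) + (f v - Suc k))"
    by (rule sum.cong) auto
  also have "\<dots> = card {v \<in> V. k < f v} + (\<Sum>v\<in>V. f v - Suc k)"
    using assms by (simp add: sum.distrib sum.If_cases Int_def)
  finally show ?case using Suc by simp
qed simp

text \<open>The value \<open>\<lambda>\<close> lies in \<open>[\<tau>, \<tau> + 1)\<close>, so the vertices \<open>v\<close> with \<open>cross_degree E S v > \<tau>\<close> are
  exactly those for which \<open>cross_degree E S v - \<lambda>\<close> is positive.\<close>

lemma threshold_optimal:
  assumes G: "graph V E" and S: "S \<subseteq> V" "S \<noteq> {}" and B: "B \<subseteq> V - S"
    and le: "(\<Sum>j<\<tau>. card {v \<in> V - S. j < cross_degree E S v} + card S) \<le>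
      card {e \<in> E. e \<inter> S \<noteq> {}}"
    and less: "card {e \<in> E. e \<inter> S \<noteq> {}} <
      (\<Sum>j<Suc \<tau>. card {v \<in> V - S. j < cross_degree E S v} + card S)"
    and T: "T = S \<union> {v \<in> V - S. \<tau> < cross_degree E S v}"
  shows "real (card (edges_within E S) + (\<Sum>v\<in>B. cross_degree E S v)) \<le>
    density E T * real (card S + card B)"
proof -
  let ?d = "cross_degree E S" and ?s = "real (card S)" and ?e = "real (card (edges_within E S))"
  define A where "A = {v \<in> V - S. \<tau> < ?d v}"
  have fin: "finite V" "finite S" "finite A" "finite B"
    using G S B by (auto simp: graph_def A_def intro: finite_subset)
  have TA: "T = S \<union> A" "S \<inter> A = {}" using T by (auto simp: A_def)
  have T_card: "card T = card S + card A" using TA fin by (simp add: card_Un_disjoint)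
  have T_pos: "0 < card T" using T_card S fin by (simp add: card_gt_0_iff)
  have "{e \<in> E. e \<inter> S \<noteq> {}} = {e \<in> E. e \<subseteq> S \<union> (V - S) \<and> e \<inter> S \<noteq> {}}"
    using G by (auto simp: graph_def)
  then have R: "card {e \<in> E. e \<inter> S \<noteq> {}} = card (edges_within E S) + (\<Sum>v\<in>V - S. ?d v)"
    using card_edges_touching[OF G, of "V - S" S] fin by auto
  have excess: "(\<Sum>v\<in>V - S. ?d v - \<tau>) = (\<Sum>v\<in>A. ?d v - \<tau>)"
    by (rule sum.mono_neutral_right) (use fin in \<open>auto simp: A_def\<close>)
  have layers: "(\<Sum>v\<in>V - S. ?d v) =
      (\<Sum>j<\<tau>. card {v \<in> V - S. j < ?d v}) + (\<Sum>v\<in>A. ?d v - \<tau>)"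
    using sum_diff_layers[of "V - S" ?d \<tau>] fin excess by simp
  have A_sum: "(\<Sum>v\<in>A. ?d v) = (\<Sum>v\<in>A. ?d v - \<tau>) + \<tau> * card A"
  proof -
    have "(\<Sum>v\<in>A. ?d v) = (\<Sum>v\<in>A. (?d v - \<tau>) + \<tau>)"
      by (rule sum.cong) (auto simp: A_def)
    then show ?thesis by (simp add: sum.distrib)
  qed
  define W where "W = card (edges_within E S) + (\<Sum>v\<in>A. ?d v)"
  \<comment> \<open>After the layers below \<tau> cancel, \<open>le\<close> bounds
    \<open>\<tau> * card S\<close> by the edges inside \<open>S\<close> plus the excesses over
    \<tau>; now add \<open>\<tau> * card A\<close>.\<close>
  have lo: "\<tau> * card T \<le> W"
    using le R layers A_sum T_card by (simp add: W_def sum.distrib algebra_simps)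
  \<comment> \<open>The additional layer in \<open>less\<close> is \<open>A\<close> itself; it
    raises the factor \<tau> to \<open>\<tau> + 1\<close>.\<close>
  have "card {v \<in> V - S. \<tau> < ?d v} = card A" by (simp add: A_def)
  then have hi: "W < (\<tau> + 1) * card T"
    using less R layers A_sum T_card by (simp add: W_def sum.distrib algebra_simps)
  define l where "l = real W / real (card T)"
  have l_lo: "real \<tau> \<le> l"
    using lo T_pos by (simp add: l_def field_simps flip: of_nat_mult)
  have "real W < real ((\<tau> + 1) * card T)" using hi by (simp only: of_nat_less_iff)
  then have l_hi: "l < real \<tau> + 1"
    using T_pos by (simp add: l_def field_simps)
  have "W = card {e \<in> E. e \<subseteq> S \<union> A \<and> e \<inter> S \<noteq> {}}"
    using card_edges_touching[OF G, of A S] fin TA by (simp add: W_def Int_commute)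
  also have "\<dots> \<le> card (edges_within E T)"
    by (rule card_mono) (use graph_finite_edges[OF G] TA in \<open>auto simp: edges_within_def\<close>)
  finally have dens: "l \<le> density E T"
    by (simp add: l_def density_def divide_right_mono)
  \<comment> \<open>Passing from \<open>B\<close> to \<open>A\<close> cannot decrease the sum:
    outside \<open>A\<close> the degrees are at most \<open>\<tau> \<le> l\<close>, in
    \<open>A\<close> they are at least \<open>\<tau> + 1 > l\<close>.\<close>
  have "(\<Sum>v\<in>B. real (?d v) - l) \<le> (\<Sum>v\<in>B \<inter> A. real (?d v) - l)"
  proof -
    have "(\<Sum>v\<in>B. real (?d v) - l) = (\<Sum>v\<in>B \<inter> A. real (?d v) - l) + (\<Sum>v\<in>B - A. real (?d v) - l)"
      using fin(4) by (rule sum.Int_Diff)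
    moreover have "(\<Sum>v\<in>B - A. real (?d v) - l) \<le> 0"
      by (rule sum_nonpos) (use B l_lo in \<open>auto simp: A_def not_less\<close>)
    ultimately show ?thesis by simp
  qed
  also have "\<dots> \<le> (\<Sum>v\<in>A. real (?d v) - l)"
    by (rule sum_mono2) (use fin l_hi in \<open>auto simp: A_def\<close>)
  finally have "?e + (\<Sum>v\<in>B. real (?d v)) - l * card B \<le> ?e + (\<Sum>v\<in>A. real (?d v)) - l * card A"
    by (simp add: sum_subtractf algebra_simps)
  moreover have "?e + (\<Sum>v\<in>A. real (?d v)) = l * (card S + card A)"
    using T_pos unfolding l_def W_def T_card[symmetric] by simp
  ultimately have "?e + (\<Sum>v\<in>B. real (?d v)) \<le> l * (card S + card B)"
    by (simp add: algebra_simps)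
  also have "\<dots> \<le> density E T * (card S + card B)"
    by (rule mult_right_mono[OF dens]) simp
  finally show ?thesis by simp
qed

section \<open>Comparison with the densest subgraph\<close>

lemma threshold_density:
  assumes G: "graph V E" and H: "densest_subgraph V E H" and S: "S \<subseteq> V"
    and eps: "0 \<le> \<epsilon>" "\<epsilon> < 1"
    and cover: "real (card (S \<inter> H)) \<ge> (1 - \<epsilon>) * real (card H)"
    and extra: "real (card (S - H)) \<le> \<epsilon> * real (card H)"
    and le: "(\<Sum>j<\<tau>. card {v \<in> V - S. j < cross_degree E S v} + card S) \<le>
      card {e \<in> E. e \<inter> S \<noteq> {}}"
    and less: "card {e \<in> E. e \<inter> S \<noteq> {}} <
      (\<Sum>j<Suc \<tau>. card {v \<in> V - S. j < cross_degree E S v} + card S)"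
    and T: "T = S \<union> {v \<in> V - S. \<tau> < cross_degree E S v}"
  shows "density E T \<ge> (1 - 3 * \<epsilon>) * density E H"
proof -
  define B where "B = H - S"
  have HV: "H \<subseteq> V" "H \<noteq> {}" using H by (auto simp: densest_subgraph_def)
  have fin: "finite V" "finite S" "finite H" "finite B"
    using G S HV by (auto simp: graph_def B_def intro: finite_subset)
  have h: "0 < card H" using HV fin by (simp add: card_gt_0_iff)
  have "0 < (1 - \<epsilon>) * real (card H)" using eps h by simp
  then have "S \<inter> H \<noteq> {}" using cover by fastforce
  then have S0: "S \<noteq> {}" by auto
  let ?d = "density E H"
  have d0: "0 \<le> ?d" by (simp add: density_def)
  have "card H = card (H \<inter> S) + card B"
    using card_Un_disjoint[of "H \<inter> S" B] fin by (auto simp: B_def Int_Diff_Un)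
  then have hB: "real (card H) = real (card (S \<inter> H)) + real (card B)"
    by (simp add: Int_commute)
  then have B_le: "real (card B) \<le> \<epsilon> * real (card H)"
    using cover by (simp add: algebra_simps)
  have "card S = card (S \<inter> H) + card (S - H)"
    using card_Un_disjoint[of "S \<inter> H" "S - H"] fin by (auto simp: Int_Diff_Un)
  \<comment> \<open>\<open>S\<close> and \<open>B\<close> together make up
    \<open>S \<union> H\<close>, which exceeds \<open>H\<close> by \<open>S - H\<close>
    only.\<close>
  then have SB: "real (card S + card B) \<le> (1 + \<epsilon>) * real (card H)"
    using hB extra by (simp add: algebra_simps)
  have EB: "real (card (edges_within E B)) \<le> ?d * real (card B)"
  proof (cases "B = {}")
    case True
    have "edges_within E {} = {}" using G by (auto simp: edges_within_def graph_def)
    then show ?thesis using True by simp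
  next
    case False
    then have "density E B \<le> ?d"
      using H unfolding densest_subgraph_def B_def by (meson Diff_subset order_trans)
    then show ?thesis using False fin by (simp add: density_def[of E B] field_simps card_gt_0_iff)
  qed
  have fE: "finite E" by (rule graph_finite_edges[OF G])
  \<comment> \<open>An edge of \<open>H\<close> either meets \<open>S\<close>, and then lies in
    \<open>S \<union> B\<close>, or lies entirely in \<open>B\<close>.\<close>
  have "edges_within E H \<subseteq> {e \<in> E. e \<subseteq> S \<union> B \<and> e \<inter> S \<noteq> {}} \<union> edges_within E B"
    by (auto simp: edges_within_def B_def)
  then have "card (edges_within E H) \<le>
      card ({e \<in> E. e \<subseteq> S \<union> B \<and> e \<inter> S \<noteq> {}} \<union> edges_within E B)"
    by (rule card_mono[rotated]) (use fE in \<open>auto simp: edges_within_def\<close>)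
  also have "\<dots> \<le> card {e \<in> E. e \<subseteq> S \<union> B \<and> e \<inter> S \<noteq> {}} + card (edges_within E B)"
    by (rule card_Un_le)
  also have "card {e \<in> E. e \<subseteq> S \<union> B \<and> e \<inter> S \<noteq> {}} =
      card (edges_within E S) + (\<Sum>v\<in>B. cross_degree E S v)"
    by (rule card_edges_touching[OF G]) (use fin in \<open>auto simp: B_def\<close>)
  finally have "real (card (edges_within E H)) \<le>
      real (card (edges_within E S) + (\<Sum>v\<in>B. cross_degree E S v)) + real (card (edges_within E B))"
    unfolding of_nat_add[symmetric] of_nat_le_iff .
  moreover have "real (card (edges_within E H)) = ?d * card H"
    using h by (simp add: density_def)
  moreover have "real (card (edges_within E S) + (\<Sum>v\<in>B. cross_degree E S v)) \<le>
      density E T * real (card S + card B)"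
    by (rule threshold_optimal[OF G S S0 _ le less T]) (use HV in \<open>auto simp: B_def\<close>)
  moreover have "density E T * real (card S + card B) \<le> density E T * ((1 + \<epsilon>) * real (card H))"
    by (rule mult_left_mono[OF SB]) (simp add: density_def)
  moreover have "?d * real (card B) \<le> ?d * (\<epsilon> * real (card H))"
    by (rule mult_left_mono[OF B_le d0])
  ultimately have "?d * card H \<le> density E T * ((1 + \<epsilon>) * card H) + ?d * (\<epsilon> * card H)"
    using EB by linarith
  then have "((1 - \<epsilon>) * ?d) * card H \<le> (density E T * (1 + \<epsilon>)) * card H"
    by (simp add: algebra_simps)
  then have main: "(1 - \<epsilon>) * ?d \<le> density E T * (1 + \<epsilon>)"
    using h by simp
  \<comment> \<open>The right-hand side is larger by
    \<open>\<epsilon> + 3 * \<epsilon> * \<epsilon>\<close>.\<close>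
  have "(1 - 3 * \<epsilon>) * (1 + \<epsilon>) \<le> 1 - \<epsilon>"
    using eps by (simp add: algebra_simps)
  then have "(1 - 3 * \<epsilon>) * (1 + \<epsilon>) * ?d \<le> (1 - \<epsilon>) * ?d"
    using d0 by (rule mult_right_mono)
  then have "((1 - 3 * \<epsilon>) * ?d) * (1 + \<epsilon>) \<le> density E T * (1 + \<epsilon>)"
    using main by (simp add: algebra_simps)
  then show ?thesis using eps by simp
qed

text \<open>Dropping the isolated vertices of \<open>H\<close> loses no edge, so by maximality it
  cannot shrink \<open>H\<close>; what remains is covered by edges with two endpoints each. This
  makes reading \<open>S\<close> affordable in time linear in the number of edges.\<close>

lemma card_densest_subgraph_le:
  assumes G: "graph V E" and H: "densest_subgraph V E H" and E: "E \<noteq> {}"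
  shows "card H \<le> 2 * card E"
proof -
  have fE: "finite E" by (rule graph_finite_edges[OF G])
  have HV: "H \<subseteq> V" "H \<noteq> {}" using H by (auto simp: densest_subgraph_def)
  have finV: "finite V" and c2: "\<And>e. e \<in> E \<Longrightarrow> card e = 2" using G by (auto simp: graph_def)
  then have h: "0 < card H" using HV by (meson card_gt_0_iff finite_subset)
  define F where "F = edges_within E H"
  have fF: "finite F" "F \<subseteq> E" using fE by (auto simp: F_def edges_within_def)
  obtain e where e: "e \<in> E" using E by auto
  then have "e \<subseteq> V" "e \<noteq> {}" using G c2[OF e] by (auto simp: graph_def)
  then have "density E e \<le> density E H" using H unfolding densest_subgraph_def by blast
  \<comment> \<open>A single edge has positive density, so \<open>H\<close> contains an edge and the
    union \<open>U\<close> below is nonempty.\<close>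
  moreover have "0 < density E e"
    using e c2[OF e] fE by (auto simp: density_def edges_within_def card_gt_0_iff)
  ultimately have "0 < density E H" by linarith
  then have F0: "0 < card F" by (auto simp: density_def F_def zero_less_divide_iff)
  define U where "U = \<Union> F"
  have UH: "U \<subseteq> H" by (auto simp: U_def F_def edges_within_def)
  have "edges_within E U = F"
    by (auto simp: U_def F_def edges_within_def)
  moreover obtain f where "f \<in> F" using F0 by fastforce
  then have "f \<noteq> {}" using fF c2 by fastforce
  then have U0: "U \<noteq> {}" using \<open>f \<in> F\<close> by (auto simp: U_def)
  then have "density E U \<le> density E H"
    using H HV UH unfolding densest_subgraph_def by (meson order_trans)
  moreover have "0 < card U" using U0 UH HV finV by (meson card_gt_0_iff finite_subset)
  ultimately have "card H \<le> card U"
    using F0 h by (simp add: density_def F_def[symmetric] field_simps)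
  also have "card U \<le> (\<Sum>e\<in>F. card e)"
    unfolding U_def using card_Union_le_sum_card by blast
  also have "\<dots> = (\<Sum>e\<in>F. 2)" by (rule sum.cong) (use fF c2 in auto)
  also have "\<dots> \<le> 2 * card E" using card_mono[OF fE fF(2)] by simp
  finally show ?thesis .
qed

subsection \<open>Reasoning about machine programs\<close>

text \<open>A timed total-correctness triple for a program segment. The real registers are left
  arbitrary, and \<open>p = q\<close> is allowed, as for one pass of a loop.\<close>

definition runs :: "program \<Rightarrow> nat \<Rightarrow> nat \<Rightarrow> nat \<Rightarrow> (nat \<Rightarrow> nat) \<Rightarrow> (nat \<Rightarrow> nat) \<Rightarrow>
    nat \<Rightarrow> ((nat \<Rightarrow> nat) \<Rightarrow> (nat \<Rightarrow> nat) \<Rightarrow> bool) \<Rightarrow> bool" where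
  "runs P B k p R M q Q \<longleftrightarrow>
    (\<forall>s. pc s = p \<and> reg s = R \<and> mem s = M \<and> words_below B s \<longrightarrow>
      (\<exists>j\<le>k. let s' = (step P ^^ j) s in
        pc s' = q \<and> Q (reg s') (mem s') \<and> (\<forall>i\<le>j. words_below B ((step P ^^ i) s))))"

text \<open>Instructions on real registers are excluded, so that these registers can be ignored.\<close>

fun runs_instr :: "instr \<Rightarrow> program \<Rightarrow> nat \<Rightarrow> nat \<Rightarrow> nat \<Rightarrow> (nat \<Rightarrow> nat) \<Rightarrow> (nat \<Rightarrow> nat) \<Rightarrow>
    nat \<Rightarrow> ((nat \<Rightarrow> nat) \<Rightarrow> (nat \<Rightarrow> nat) \<Rightarrow> bool) \<Rightarrow> bool" where
  "runs_instr (Const i c) P B k p R M q Q \<longleftrightarrow> c < B \<and> runs P B k (Suc p) (R(i := c)) M q Q"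
| "runs_instr (Arith f i j l) P B k p R M q Q \<longleftrightarrow>
    nat_op f (R j) (R l) < B \<and> runs P B k (Suc p) (R(i := nat_op f (R j) (R l))) M q Q"
| "runs_instr (Load i j) P B k p R M q Q \<longleftrightarrow> runs P B k (Suc p) (R(i := M (R j))) M q Q"
| "runs_instr (Store i j) P B k p R M q Q \<longleftrightarrow> runs P B k (Suc p) R (M(R i := R j)) q Q"
| "runs_instr (Jump l) P B k p R M q Q \<longleftrightarrow> runs P B k l R M q Q"
| "runs_instr (JumpLess i j l) P B k p R M q Q \<longleftrightarrow>
    runs P B k (if R i < R j then l else Suc p) R M q Q"
| "runs_instr _ P B k p R M q Q \<longleftrightarrow> False"

lemma runs_done: "Q R M \<Longrightarrow> runs P B k q R M q Q"
  by (auto simp: runs_def Let_def intro!: exI[of _ 0])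

lemma runs_exec:
  assumes p: "p < length P" and k: "0 < k"
    and ex: "\<And>s. pc s = p \<Longrightarrow> reg s = R \<Longrightarrow> mem s = M \<Longrightarrow> words_below B s \<Longrightarrow>
      pc (exec (P ! p) s) = p' \<and> reg (exec (P ! p) s) = R' \<and> mem (exec (P ! p) s) = M' \<and>
      words_below B (exec (P ! p) s)"
    and runs: "runs P B (k - 1) p' R' M' q Q"
  shows "runs P B k p R M q Q"
  unfolding runs_def
proof (intro allI impI)
  fix s assume s: "pc s = p \<and> reg s = R \<and> mem s = M \<and> words_below B s"
  have st: "step P s = exec (P ! p) s" using s p by (simp add: step_def halted_def)
  obtain j where j: "j \<le> k - 1" and
    fin: "pc ((step P ^^ j) (step P s)) = q"
      "Q (reg ((step P ^^ j) (step P s))) (mem ((step P ^^ j) (step P s)))" and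
    wb: "\<forall>i\<le>j. words_below B ((step P ^^ i) (step P s))"
    using runs ex s unfolding runs_def st Let_def by blast
  have shift: "(step P ^^ Suc i) s = (step P ^^ i) (step P s)" for i
    by (simp add: funpow_swap1)
  have "words_below B ((step P ^^ i) s)" if "i \<le> Suc j" for i
    using that s wb shift by (cases i) auto
  then show "\<exists>j\<le>k. let s' = (step P ^^ j) s in
      pc s' = q \<and> Q (reg s') (mem s') \<and> (\<forall>i\<le>j. words_below B ((step P ^^ i) s))"
    using j k fin shift by (auto simp: Let_def simp del: funpow.simps intro!: exI[of _ "Suc j"])
qed

lemma runs_step:
  assumes "0 < k" "p < length P \<and> P ! p = c" "runs_instr c P B (k - 1) p R M q Q"
  shows "runs P B k p R M q Q"
proof (cases c)
  case (Const i c)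
  show ?thesis
    by (rule runs_exec[where p' = "Suc p" and R' = "R(i := c)" and M' = M])
      (use assms Const in \<open>auto simp: words_below_def\<close>)
next
  case (Arith f i j l)
  show ?thesis
    by (rule runs_exec[where p' = "Suc p" and R' = "R(i := nat_op f (R j) (R l))" and M' = M])
      (use assms Arith in \<open>auto simp: words_below_def\<close>)
next
  case (Load i j)
  show ?thesis
    by (rule runs_exec[where p' = "Suc p" and R' = "R(i := M (R j))" and M' = M])
      (use assms Load in \<open>auto simp: words_below_def\<close>)
next
  case (Store i j)
  show ?thesis
    by (rule runs_exec[where p' = "Suc p" and R' = R and M' = "M(R i := R j)"])
      (use assms Store in \<open>auto simp: words_below_def\<close>)
next
  case (Jump l)
  show ?thesis
    by (rule runs_exec[where p' = l and R' = R and M' = M])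
      (use assms Jump in \<open>auto simp: words_below_def\<close>)
next
  case (JumpLess i j l)
  show ?thesis
    by (rule runs_exec[where p' = "if R i < R j then l else Suc p" and R' = R and M' = M])
      (use assms JumpLess in \<open>auto simp: words_below_def\<close>)
qed (use assms in auto)

text \<open>The redundant condition \<open>p \<noteq> q\<close> stops a repeated application of this rule at the target.\<close>

lemma runs_step_to:
  assumes "p \<noteq> q \<and> 0 < k" "p < length P \<and> P ! p = c" "runs_instr c P B (k - 1) p R M q Q"
  shows "runs P B k p R M q Q"
  using assms by (intro runs_step) auto

lemma runs_trans:
  assumes 1: "runs P B k p R M q Q" and 2: "\<And>R' M'. Q R' M' \<Longrightarrow> runs P B l q R' M' r Q'"
  shows "runs P B (k + l) p R M r Q'"
  unfolding runs_def
proof (intro allI impI)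
  fix s assume s: "pc s = p \<and> reg s = R \<and> mem s = M \<and> words_below B s"
  obtain j where j: "j \<le> k" "pc ((step P ^^ j) s) = q"
      "Q (reg ((step P ^^ j) s)) (mem ((step P ^^ j) s))"
      "\<forall>i\<le>j. words_below B ((step P ^^ i) s)"
    using 1 s unfolding runs_def Let_def by blast
  obtain h where h: "h \<le> l" "pc ((step P ^^ h) ((step P ^^ j) s)) = r"
      "Q' (reg ((step P ^^ h) ((step P ^^ j) s))) (mem ((step P ^^ h) ((step P ^^ j) s)))"
      "\<forall>i\<le>h. words_below B ((step P ^^ i) ((step P ^^ j) s))"
    using 2[OF j(3)] j unfolding runs_def Let_def by blast
  have add: "(step P ^^ i) ((step P ^^ j) s) = (step P ^^ (i + j)) s" for i
    by (simp add: funpow_add)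
  have "words_below B ((step P ^^ i) s)" if "i \<le> h + j" for i
  proof (cases "i \<le> j")
    case False
    then have "i - j \<le> h" "i = (i - j) + j" using that by auto
    then show ?thesis using h(4) add by metis
  qed (use j in auto)
  then show "\<exists>j\<le>k + l. let s' = (step P ^^ j) s in
      pc s' = r \<and> Q' (reg s') (mem s') \<and> (\<forall>i\<le>j. words_below B ((step P ^^ i) s))"
    using j(1) h(1-3) add by (auto simp: Let_def intro!: exI[of _ "h + j"])
qed

lemma runs_mono:
  assumes "runs P B k p R M q Q" "k \<le> l" "\<And>R' M'. Q R' M' \<Longrightarrow> Q' R' M'"
  shows "runs P B l p R M q Q'"
proof -
  have "runs P B (k + (l - k)) p R M q Q'"
    by (rule runs_trans[OF assms(1)]) (simp add: assms(3) runs_done)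
  then show ?thesis using assms(2) by simp
qed

text \<open>The number of passes is known beforehand; leaving the loop once \<open>I N\<close> holds
  is a segment of its own.\<close>

lemma runs_loop:
  assumes body: "\<And>i R M. i < N \<Longrightarrow> I i R M \<Longrightarrow> runs P B c p R M p (I (Suc i))"
    and "I 0 R M"
  shows "runs P B (N * c) p R M p (I N)"
proof -
  have "runs P B (i * c) p R M p (I i)" if "i \<le> N" for i
    using that
  proof (induction i)
    case 0
    then show ?case using assms(2) by (simp add: runs_done)
  next
    case (Suc i)
    have "runs P B (i * c + c) p R M p (I (Suc i))"
      by (rule runs_trans[where Q = "I i"]) (use Suc body in auto)
    then show ?case by (simp add: add.commute)
  qed
  then show ?thesis by simp
qed

lemma runs_halts_within:
  assumes "runs P B k (pc s) (reg s) (mem s) q Q" "words_below B s" "length P \<le> q"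
  obtains s' where "halts_within P B k s s'" "Q (reg s') (mem s')"
proof -
  obtain j where "j \<le> k" "pc ((step P ^^ j) s) = q"
      "Q (reg ((step P ^^ j) s)) (mem ((step P ^^ j) s))"
      "\<forall>i\<le>j. words_below B ((step P ^^ i) s)"
    using assms unfolding runs_def Let_def by blast
  with assms(3) show thesis
    by (intro that[of "(step P ^^ j) s"]) (auto simp: halts_within_def halted_def)
qed

subsection \<open>The program\<close>

text \<open>
  Memory: with \<open>m\<close> edges and \<open>k = |S|\<close>, the input occupies the addresses below \<open>2m + 3 + k\<close> and
  ends with the elements of \<open>S\<close>. The next \<open>2m + 2\<close> addresses are left for extending this list to
  the output. From \<open>base = 4m + 5 + k\<close> on there are three tables: membership in \<open>S\<close> (\<open>n\<close> words),
  numbers of neighbours in \<open>S\<close> of the vertices outside \<open>S\<close> (\<open>n\<close> words), and, at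
  \<open>base + 2n + j\<close> for \<open>j \<ge> 1\<close>, the number of vertices with at least \<open>j\<close> such neighbours. The last
  table can be maintained while the edges are scanned: when a vertex gains its \<open>j\<close>-th neighbour, only
  entry \<open>j\<close> changes. The tables are never cleared, which would take time \<open>n\<close>: the
  memory is initially zero.

  Registers: 0 and 1 are the output, 2 to 4 hold \<open>n\<close>, \<open>m\<close>, \<open>k\<close>, 5 to 7 the starts of the tables, 8
  the constant 1, 9 the address of the loop, 10 the end of the edge list, 15 the number of edges
  touching \<open>S\<close> minus the charge of the current threshold, 16 the threshold plus one, 18 the
  constant 0.
\<close>

definition threshold_program :: program where
  "threshold_program =
   [Const 8 1, Load 2 18, Load 3 8, Const 0 1, Const 1 1, JumpLess 3 8 69, Const 9 2,
    Arith Add 10 3 3, Arith Add 10 10 9, Load 4 10, Arith Add 0 10 8, Arith Add 14 0 4,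
    Arith Add 5 14 10, Arith Add 6 5 2, Arith Add 7 6 2, Arith Add 9 0 18, Jump 21,
    \<comment> \<open>17: mark the elements of \<open>S\<close>; loop test at 21\<close>
    Load 11 9, Arith Add 11 5 11, Store 11 8, Arith Add 9 9 8,
    JumpLess 9 14 17, Const 9 2, Jump 47,
    \<comment> \<open>24: scan the edges; loop test at 47\<close>
    Load 11 9, Arith Add 9 9 8, Load 12 9, Arith Add 9 9 8, Arith Add 13 5 11, Load 13 13,
    Arith Add 14 5 12, Load 14 14, Arith Add 17 13 14, JumpLess 17 8 47, Arith Add 15 15 8,
    JumpLess 13 14 39, JumpLess 14 13 38, Jump 47,
    Arith Add 11 12 18,
    Arith Add 11 6 11, Load 12 11, Arith Add 12 12 8, Store 11 12, Arith Add 12 7 12, Load 13 12,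
    Arith Add 13 13 8, Store 12 13,
    JumpLess 9 10 24, Const 16 1, Arith Add 12 7 8,
    \<comment> \<open>50: raise the threshold\<close>
    Load 11 12, Arith Add 11 11 4, JumpLess 15 11 57, Arith Sub 15 15 11, Arith Add 16 16 8,
    Arith Add 12 12 8, Jump 50,
    Const 9 2, Arith Add 13 0 4, Jump 67,
    \<comment> \<open>60: append the endpoints above the threshold; loop test at 67\<close>
    Load 11 9, Arith Add 9 9 8, Arith Add 12 6 11, Load 12 12, JumpLess 12 16 67, Store 13 11,
    Arith Add 13 13 8,
    JumpLess 9 10 60, Arith Sub 1 13 0]"

text \<open>The value 0 on \<open>S\<close> keeps the vertices of \<open>S\<close> out of the counts
  and out of the selection, whatever the threshold.\<close>

definition list_cross_degree :: "nat set \<Rightarrow> (nat \<times> nat) list \<Rightarrow> nat \<Rightarrow> nat" where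
  "list_cross_degree S es v =
    (if v \<in> S then 0 else length (filter (\<lambda>(u, w). u = v \<and> w \<in> S \<or> w = v \<and> u \<in> S) es))"

definition list_touching :: "nat set \<Rightarrow> (nat \<times> nat) list \<Rightarrow> nat" where
  "list_touching S es = length (filter (\<lambda>(u, w). u \<in> S \<or> w \<in> S) es)"

definition count_above :: "nat \<Rightarrow> nat set \<Rightarrow> (nat \<times> nat) list \<Rightarrow> nat \<Rightarrow> nat" where
  "count_above n S es j = card {v. v < n \<and> j < list_cross_degree S es v}"

definition endpoints :: "(nat \<times> nat) list \<Rightarrow> nat list" where
  "endpoints es = concat (map (\<lambda>(u, v). [u, v]) es)"

lemma length_endpoints [simp]: "length (endpoints es) = 2 * length es"
  by (induction es) (auto simp: endpoints_def)

lemma endpoints_nth: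
  assumes "i < length es"
  shows "endpoints es ! (2 * i) = fst (es ! i)" "endpoints es ! Suc (2 * i) = snd (es ! i)"
  using assms
proof (induction es arbitrary: i)
  case (Cons e es)
  { case 1 then show ?case using Cons.IH by (cases i; cases e) (auto simp: endpoints_def) }
  { case 2 then show ?case using Cons.IH by (cases i; cases e) (auto simp: endpoints_def) }
qed auto

lemma list_cross_degree_same:
  "u \<in> S \<longleftrightarrow> v \<in> S \<Longrightarrow> list_cross_degree S (fs @ [(u, v)]) = list_cross_degree S fs"
  by (auto simp: list_cross_degree_def fun_eq_iff)

lemma list_cross_degree_cross:
  assumes "w \<notin> S" "w' \<in> S" "e = (w, w') \<or> e = (w', w)"
  shows "list_cross_degree S (fs @ [e]) =
    (list_cross_degree S fs)(w := Suc (list_cross_degree S fs w))"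
  using assms by (auto simp: list_cross_degree_def fun_eq_iff)

lemma count_above_cross:
  assumes "w \<notin> S" "w' \<in> S" "e = (w, w') \<or> e = (w', w)" "w < n"
  shows "count_above n S (fs @ [e]) = (count_above n S fs)
    (list_cross_degree S fs w := Suc (count_above n S fs (list_cross_degree S fs w)))"
proof
  fix j
  let ?d = "list_cross_degree S fs"
  have "{v. v < n \<and> j < list_cross_degree S (fs @ [e]) v} =
      (if j = ?d w then insert w {v. v < n \<and> j < ?d v} else {v. v < n \<and> j < ?d v})"
    using assms(4) unfolding list_cross_degree_cross[OF assms(1-3)] by (auto split: if_splits)
  then show "count_above n S (fs @ [e]) j =
      ((count_above n S fs)(?d w := Suc (count_above n S fs (?d w)))) j"
    by (simp add: count_above_def)
qed

lemma list_cross_degree_le: "list_cross_degree S fs v \<le> length fs"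
  by (simp add: list_cross_degree_def)

lemma list_touching_le: "list_touching S fs \<le> length fs"
  by (simp add: list_touching_def)

lemma count_above_le: "count_above n S fs j \<le> n"
proof -
  have "card {v. v < n \<and> j < list_cross_degree S fs v} \<le> card {..<n}"
    by (rule card_mono) auto
  then show ?thesis by (simp add: count_above_def)
qed

section \<open>Memory layout, loop invariants and the threshold\<close>

locale threshold_run =
  fixes n :: nat and es :: "(nat \<times> nat) list" and vs :: "nat list" and B :: nat
  assumes edges: "\<And>u v. (u, v) \<in> set es \<Longrightarrow> u < n \<and> v < n"
    and vs: "distinct vs" "set vs \<subseteq> {..<n}" "vs \<noteq> []"
    and es: "es \<noteq> []"
    and B: "8 * (n + length es + 2) \<le> B"
begin

abbreviation "m \<equiv> length es"
abbreviation "k \<equiv> length vs"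
abbreviation "S \<equiv> set vs"

definition base :: nat where "base = 4 * m + 5 + k"

definition mem0 :: "nat \<Rightarrow> nat" where
  "mem0 a = (if a < length (encode_input n es vs) then encode_input n es vs ! a else 0)"

definition tables :: "nat set \<Rightarrow> (nat \<times> nat) list \<Rightarrow> (nat \<Rightarrow> nat) \<Rightarrow> bool" where
  "tables U fs M \<longleftrightarrow>
    (\<forall>v<n. M (base + v) = of_bool (v \<in> U)) \<and>
    (\<forall>v<n. M (base + n + v) = list_cross_degree U fs v) \<and>
    (\<forall>j. M (base + 2 * n + Suc j) = count_above n U fs j)"

definition fixed_regs :: "(nat \<Rightarrow> nat) \<Rightarrow> bool" where
  "fixed_regs R \<longleftrightarrow> R 0 = 2 * m + 3 \<and> R 4 = k \<and> R 5 = base \<and> R 6 = base + n \<and> R 7 = base + 2 * n \<and>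
    R 8 = 1 \<and> R 10 = 2 * m + 2 \<and> R 18 = 0"

lemma k_bounds: "0 < k" "k \<le> n"
  using vs card_mono[of "{..<n}" S] by (auto simp: distinct_card)

lemma bounds: "base + 3 * n + m + 10 < B"
  using B k_bounds by (simp add: base_def)

lemma mem0_props:
  shows "mem0 0 = n" "mem0 1 = m"
    and "i < 2 * m \<Longrightarrow> mem0 (2 + i) = endpoints es ! i"
    and "mem0 (2 * m + 2) = k"
    and "i < k \<Longrightarrow> mem0 (2 * m + 3 + i) = vs ! i"
    and "2 * m + 3 + k \<le> a \<Longrightarrow> mem0 a = 0"
proof -
  have enc: "encode_input n es vs = n # m # endpoints es @ k # vs"
    by (simp add: encode_input_def endpoints_def)
  show "mem0 0 = n" "mem0 1 = m" "mem0 (2 * m + 2) = k"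
    by (simp_all add: mem0_def enc nth_append)
  show "mem0 (2 + i) = endpoints es ! i" if "i < 2 * m"
    using that by (simp add: mem0_def enc nth_append)
  show "mem0 (2 * m + 3 + i) = vs ! i" if "i < k"
    using that by (simp add: mem0_def enc nth_append numeral_3_eq_3)
  show "mem0 a = 0" if "2 * m + 3 + k \<le> a"
    using that by (simp add: mem0_def enc)
qed

lemma endpoints_less: "i < 2 * m \<Longrightarrow> endpoints es ! i < n"
proof -
  assume "i < 2 * m"
  then have "endpoints es ! i \<in> set (endpoints es)" by (intro nth_mem) simp
  then show ?thesis using edges by (auto simp: endpoints_def)
qed

definition inv_mark :: "nat \<Rightarrow> (nat \<Rightarrow> nat) \<Rightarrow> (nat \<Rightarrow> nat) \<Rightarrow> bool" where
  "inv_mark i R M \<longleftrightarrow> fixed_regs R \<and> R 9 = 2 * m + 3 + i \<and> R 14 = 2 * m + 3 + k \<and> R 15 = 0 \<and>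
    (\<forall>a<base. M a = mem0 a) \<and> tables (set (take i vs)) [] M"

definition inv_scan :: "nat \<Rightarrow> (nat \<Rightarrow> nat) \<Rightarrow> (nat \<Rightarrow> nat) \<Rightarrow> bool" where
  "inv_scan i R M \<longleftrightarrow> fixed_regs R \<and> R 9 = 2 + 2 * i \<and> R 15 = list_touching S (take i es) \<and>
    (\<forall>a<base. M a = mem0 a) \<and> tables S (take i es) M"

text \<open>If \<open>X\<close> edges touch \<open>S\<close>, then \<open>X - charge t\<close> is the number of edges inside \<open>S\<close> plus
  \<open>\<Sum>v. max 0 (deg v - t)\<close> minus \<open>t * |S|\<close>, where \<open>v\<close> ranges over the vertices outside \<open>S\<close>.\<close>

definition charge :: "nat \<Rightarrow> nat" where
  "charge t = (\<Sum>j<t. count_above n S es j + k)"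

text \<open>By minimality also \<open>charge threshold \<le> list_touching S es\<close>. Together
  with the defining inequality this gives the two conditions on \<tau> in
  \<open>threshold_optimal\<close>.\<close>

definition threshold :: nat where
  "threshold = (LEAST t. list_touching S es < charge (Suc t))"

text \<open>For \<open>i\<close> up to \<open>threshold\<close> the truncated subtraction is exact,
  because the charge is then at most the number of touching edges.\<close>

definition inv_raise :: "nat \<Rightarrow> (nat \<Rightarrow> nat) \<Rightarrow> (nat \<Rightarrow> nat) \<Rightarrow> bool" where
  "inv_raise i R M \<longleftrightarrow> fixed_regs R \<and> R 12 = base + 2 * n + Suc i \<and> R 16 = Suc i \<and>
    R 15 = list_touching S es - charge i \<and> (\<forall>a<base. M a = mem0 a) \<and> tables S es M"

text \<open>A vertex above the threshold is appended once for each of its edges, so repetitions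
  occur; only the set of entries matters.\<close>

definition selected :: "nat \<Rightarrow> nat list" where
  "selected i = vs @ filter (\<lambda>v. threshold < list_cross_degree S es v) (take i (endpoints es))"

definition inv_select :: "nat \<Rightarrow> (nat \<Rightarrow> nat) \<Rightarrow> (nat \<Rightarrow> nat) \<Rightarrow> bool" where
  "inv_select i R M \<longleftrightarrow> fixed_regs R \<and> R 9 = 2 + i \<and> R 13 = 2 * m + 3 + length (selected i) \<and>
    R 16 = Suc threshold \<and> (\<forall>a<2 * m + 3. M a = mem0 a) \<and>
    (\<forall>j<length (selected i). M (2 * m + 3 + j) = selected i ! j) \<and>
    (\<forall>v<n. M (base + n + v) = list_cross_degree S es v)"

text \<open>Each level charges at least \<open>k > 0\<close>. Hence the threshold exists and is at
  most \<open>m\<close>.\<close>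

lemma charge_ge: "t \<le> charge t"
proof -
  have "(\<Sum>j<t. 1) \<le> charge t" unfolding charge_def
    by (rule sum_mono) (use k_bounds(1) in linarith)
  then show ?thesis by simp
qed

lemma threshold_less: "list_touching S es < charge (Suc threshold)"
  unfolding threshold_def
proof (rule LeastI)
  show "list_touching S es < charge (Suc m)"
    using list_touching_le[of S es] charge_ge[of "Suc m"] by linarith
qed

lemma threshold_charge_le: "i < threshold \<Longrightarrow> charge (Suc i) \<le> list_touching S es"
  unfolding threshold_def using not_less_Least not_le_imp_less by blast

lemma charge_threshold_le: "charge threshold \<le> list_touching S es"
  using threshold_charge_le[of "threshold - 1"] by (cases threshold) (auto simp: charge_def)

lemma threshold_le: "threshold \<le> m"
  using charge_threshold_le list_touching_le[of S es] charge_ge[of threshold] by linarith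

lemma tables_mark:
  assumes "tables (set (take i vs)) [] M" "i < k"
  shows "tables (set (take (Suc i) vs)) [] (M(base + vs ! i := 1))"
proof -
  have "vs ! i < n" using vs assms(2) nth_mem by blast
  then show ?thesis
    using assms by (auto simp: tables_def take_Suc_conv_app_nth list_cross_degree_def count_above_def)
qed

lemma tables_scan:
  assumes "tables S fs M" "w \<notin> S" "w' \<in> S" "e = (w, w') \<or> e = (w', w)" "w < n"
  shows "tables S (fs @ [e]) (M(base + n + w := Suc (list_cross_degree S fs w),
    base + 2 * n + Suc (list_cross_degree S fs w) := Suc (count_above n S fs (list_cross_degree S fs w))))"
  using assms(1,5) unfolding tables_def list_cross_degree_cross[OF assms(2-4)]
    count_above_cross[OF assms(2-5)]
  by auto

section \<open>Execution of the phases\<close>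

abbreviation "prog_runs \<equiv> runs threshold_program B"

lemma run_mark_step:
  assumes "i < k" "inv_mark i R M"
  shows "prog_runs 5 21 R M 21 (inv_mark (Suc i))"
proof -
  define a where "a = 2 * m + 3 + i"
  define z where "z = 2 * m + 3 + k"
  define v where "v = vs ! i"
  have v: "v < n" using vs assms(1) nth_mem unfolding v_def by blast
  have "a < base" using assms(1) by (simp add: a_def base_def)
  then have facts: "fixed_regs R" "R 9 = a" "R 14 = z" "R 15 = 0" "M a = v" "a < z" "v < n" "a < base"
    "\<forall>a<base. M a = mem0 a" "tables (set (take (Suc i) vs)) [] (M(base + v := 1))"
    using assms tables_mark mem0_props(5) v unfolding inv_mark_def v_def a_def z_def by auto
  \<comment> \<open>The body starts and ends at 21, so its first instruction is taken with
    \<open>runs_step\<close>; afterwards \<open>runs_step_to\<close> stops on the return to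
    21.\<close>
  have "prog_runs 5 21 R M 21 (\<lambda>R' M'. fixed_regs R' \<and> R' 9 = Suc a \<and> R' 14 = z \<and> R' 15 = 0 \<and>
    M' = M(base + v := 1))"
    using facts(1-8) bounds unfolding fixed_regs_def
    by - (rule runs_step, simp, simp add: threshold_program_def, simp,
        (rule runs_step_to, (simp; fail), simp add: threshold_program_def, simp)+,
        rule runs_done, simp)
  then show ?thesis
    by (rule runs_mono) (use facts in \<open>auto simp: inv_mark_def a_def z_def\<close>)
qed

lemma run_setup: "prog_runs 17 0 (\<lambda>_. 0) mem0 21 (inv_mark 0)"
proof -
  define m' where "m' = m"
  have facts: "mem0 0 = n" "mem0 (Suc 0) = m'" "mem0 (Suc (Suc (m' + m'))) = k" "0 < m'" "k \<le> n"
    using mem0_props es k_bounds unfolding m'_def by (auto simp flip: mult_2)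
  have lim: "6 * m' + 5 * n + 15 < B" using B es by (simp add: m'_def)
  have "prog_runs 17 0 (\<lambda>_. 0) mem0 21 (\<lambda>R M. R 0 = m' + m' + 3 \<and> R 4 = k \<and>
      R 5 = m' + m' + 3 + k + (m' + m' + 2) \<and> R 6 = R 5 + n \<and> R 7 = R 5 + n + n \<and>
      R 8 = 1 \<and> R 10 = m' + m' + 2 \<and> R 18 = 0 \<and> R 9 = R 0 \<and> R 14 = R 0 + k \<and> R 15 = 0 \<and> M = mem0)"
    using facts lim
    by - ((rule runs_step_to, (simp; fail), simp add: threshold_program_def, simp)+,
        rule runs_done, simp)
  then show ?thesis
  proof (rule runs_mono)
    have "tables {} [] mem0"
      unfolding tables_def base_def by (auto simp: mem0_props(6) list_cross_degree_def count_above_def)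
    then show "inv_mark 0 R M" if "R 0 = m' + m' + 3 \<and> R 4 = k \<and>
      R 5 = m' + m' + 3 + k + (m' + m' + 2) \<and> R 6 = R 5 + n \<and> R 7 = R 5 + n + n \<and>
      R 8 = 1 \<and> R 10 = m' + m' + 2 \<and> R 18 = 0 \<and> R 9 = R 0 \<and> R 14 = R 0 + k \<and> R 15 = 0 \<and> M = mem0"
      for R M
      using that by (simp add: inv_mark_def fixed_regs_def base_def m'_def)
  qed simp
qed

lemma run_mark_exit:
  assumes "inv_mark k R M"
  shows "prog_runs 3 21 R M 47 (inv_scan 0)"
proof -
  have facts: "fixed_regs R" "R 9 = R 14" "R 15 = 0"
    using assms by (auto simp: inv_mark_def)
  have "prog_runs 3 21 R M 47 (\<lambda>R' M'. fixed_regs R' \<and> R' 9 = 2 \<and> R' 15 = 0 \<and> M' = M)"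
    using facts bounds unfolding fixed_regs_def
    by - ((rule runs_step_to, (simp; fail), simp add: threshold_program_def, simp)+,
        rule runs_done, simp)
  then show ?thesis
    by (rule runs_mono) (use assms in \<open>auto simp: inv_mark_def inv_scan_def list_touching_def\<close>)
qed

lemma run_scan_step:
  assumes i: "i < m" and inv: "inv_scan i R M"
  shows "prog_runs 24 47 R M 47 (inv_scan (Suc i))"
proof -
  obtain u v where uv: "es ! i = (u, v)" by fastforce
  then have less: "u < n" "v < n" using edges i nth_mem by metis+
  have take: "take (Suc i) es = take i es @ [(u, v)]"
    using i uv by (simp add: take_Suc_conv_app_nth)
  let ?fs = "take i es"
  define a where "a = 2 + 2 * i"
  define z where "z = 2 * m + 2"
  define x where "x = list_touching S ?fs"
  have x: "x \<le> m" using list_touching_le[of S ?fs] i by (simp add: x_def)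
  have a: "Suc a < z" "z < base" using i by (simp_all add: a_def base_def z_def)
  have "mem0 a = u" "mem0 (Suc a) = v"
    using mem0_props(3)[of "2 * i"] mem0_props(3)[of "Suc (2 * i)"] endpoints_nth[of i es] i uv
    by (simp_all add: a_def)
  then have M: "M a = u" "M (Suc a) = v" and mem: "\<forall>a<base. M a = mem0 a" and tab: "tables S ?fs M"
    using inv a by (auto simp: inv_scan_def)
  have R: "fixed_regs R" "R 9 = a" "R 10 = z" "R 15 = x"
    using inv by (auto simp: inv_scan_def a_def x_def z_def fixed_regs_def)
  have marks: "M (base + u) = of_bool (u \<in> S)" "M (base + v) = of_bool (v \<in> S)"
    using tab less by (auto simp: tables_def)
  note facts = R M a less x
  define d where "d w = list_cross_degree S ?fs w" for w
  define c where "c w = count_above n S ?fs (d w)" for w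
  have dc: "M (base + n + w) = d w" "M (base + 2 * n + Suc (d w)) = c w" "d w \<le> m" "c w \<le> n"
    if "w < n" for w
    using that tab list_cross_degree_le[of S ?fs w] count_above_le[of n S ?fs "d w"] i
    by (auto simp: tables_def d_def c_def)
  define upd where "upd w = M(base + n + w := Suc (d w), base + 2 * n + Suc (d w) := Suc (c w))" for w
  have upd: "tables S (take (Suc i) es) (upd w)" "\<forall>a<base. upd w a = mem0 a"
    if "w \<notin> S" "w' \<in> S" "(u, v) = (w, w') \<or> (u, v) = (w', w)" "w < n" for w w'
    using tables_scan[OF tab that] mem unfolding take upd_def d_def c_def by auto
  have cross: "prog_runs 24 47 R M 47 (inv_scan (Suc i))"
    if "prog_runs 24 47 R M 47 (\<lambda>R' M'. fixed_regs R' \<and> R' 9 = Suc (Suc a) \<and> R' 15 = Suc x \<and> M' = upd w)"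
      "w \<notin> S" "w' \<in> S" "(u, v) = (w, w') \<or> (u, v) = (w', w)" "w < n" for w w'
  proof (rule runs_mono[OF that(1)])
    show "inv_scan (Suc i) R' M'"
      if "fixed_regs R' \<and> R' 9 = Suc (Suc a) \<and> R' 15 = Suc x \<and> M' = upd w" for R' M'
      using that upd[OF \<open>w \<notin> S\<close> \<open>w' \<in> S\<close> \<open>_ \<or> _\<close> \<open>w < n\<close>] \<open>w' \<in> S\<close> \<open>_ \<or> _\<close>
      by (auto simp: inv_scan_def a_def x_def take list_touching_def)
  qed simp
  \<comment> \<open>These are the branches of the program: without marks nothing is recorded, with
    two marks only the counter of touching edges moves, and with one mark \<open>upd\<close> is also
    applied to the unmarked endpoint.\<close>
  consider "u \<notin> S" "v \<notin> S" | "u \<in> S" "v \<in> S" | "u \<in> S" "v \<notin> S" | "u \<notin> S" "v \<in> S" by blast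
  then show ?thesis
  proof cases
    case 1
    then have "M (base + u) = 0" "M (base + v) = 0" using marks by auto
    then have "prog_runs 24 47 R M 47
        (\<lambda>R' M'. fixed_regs R' \<and> R' 9 = Suc (Suc a) \<and> R' 15 = x \<and> M' = M)"
      using facts bounds unfolding fixed_regs_def
      by - (rule runs_step, simp, simp add: threshold_program_def, simp,
          (rule runs_step_to, (simp; fail), simp add: threshold_program_def, simp)+,
          rule runs_done, simp)
    then show ?thesis
      by (rule runs_mono) (use 1 mem tab in \<open>auto simp: inv_scan_def a_def x_def take list_touching_def
        tables_def list_cross_degree_same count_above_def\<close>)
  next
    case 2
    then have "M (base + u) = 1" "M (base + v) = 1" using marks by auto
    then have "prog_runs 24 47 R M 47
        (\<lambda>R' M'. fixed_regs R' \<and> R' 9 = Suc (Suc a) \<and> R' 15 = Suc x \<and> M' = M)"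
      using facts bounds unfolding fixed_regs_def
      by - (rule runs_step, simp, simp add: threshold_program_def, simp,
          (rule runs_step_to, (simp; fail), simp add: threshold_program_def, simp)+,
          rule runs_done, simp)
    then show ?thesis
      by (rule runs_mono) (use 2 mem tab in \<open>auto simp: inv_scan_def a_def x_def take list_touching_def
        tables_def list_cross_degree_same count_above_def\<close>)
  next
    case 3
    then have "M (base + u) = 1" "M (base + v) = 0" using marks by auto
    then have "prog_runs 24 47 R M 47
        (\<lambda>R' M'. fixed_regs R' \<and> R' 9 = Suc (Suc a) \<and> R' 15 = Suc x \<and> M' = upd v)"
      using facts dc[OF less(2)] bounds unfolding fixed_regs_def
      by - (rule runs_step, simp, simp add: threshold_program_def, simp,
          (rule runs_step_to, (simp; fail), simp add: threshold_program_def, simp)+,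
          rule runs_done, simp add: upd_def)
    then show ?thesis by (rule cross) (use 3 less in auto)
  next
    case 4
    then have "M (base + u) = 0" "M (base + v) = 1" using marks by auto
    then have "prog_runs 24 47 R M 47
        (\<lambda>R' M'. fixed_regs R' \<and> R' 9 = Suc (Suc a) \<and> R' 15 = Suc x \<and> M' = upd u)"
      using facts dc[OF less(1)] bounds unfolding fixed_regs_def
      by - (rule runs_step, simp, simp add: threshold_program_def, simp,
          (rule runs_step_to, (simp; fail), simp add: threshold_program_def, simp)+,
          rule runs_done, simp add: upd_def)
    then show ?thesis by (rule cross) (use 4 less in auto)
  qed
qed

lemma run_scan_exit:
  assumes "inv_scan m R M"
  shows "prog_runs 3 47 R M 50 (inv_raise 0)"
proof -
  have facts: "fixed_regs R" "R 9 = 2 * m + 2"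
    using assms by (auto simp: inv_scan_def)
  have "prog_runs 3 47 R M 50 (\<lambda>R' M'. fixed_regs R' \<and> R' 12 = Suc (base + 2 * n) \<and> R' 16 = 1 \<and>
      R' 15 = R 15 \<and> M' = M)"
    using facts bounds unfolding fixed_regs_def
    by - ((rule runs_step_to, (simp; fail), simp add: threshold_program_def, simp)+,
        rule runs_done, simp)
  then show ?thesis
    by (rule runs_mono) (use assms in \<open>auto simp: inv_scan_def inv_raise_def charge_def\<close>)
qed

lemma run_raise_step:
  assumes i: "i < threshold" and inv: "inv_raise i R M"
  shows "prog_runs 7 50 R M 50 (inv_raise (Suc i))"
proof -
  define a where "a = base + 2 * n + Suc i"
  define x where "x = list_touching S es - charge i"
  define c where "c = count_above n S es i"
  have facts: "fixed_regs R" "R 12 = a" "R 16 = Suc i" "R 15 = x" "M a = c" "c \<le> n" "i < m"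
      "a = base + 2 * n + Suc i" "x \<le> m" "k \<le> n" "c + k \<le> x"
      "x - (c + k) < B"
    using inv bounds i threshold_le count_above_le[of n S es i] list_touching_le[of S es] k_bounds
      threshold_charge_le[OF i]
    by (auto simp: inv_raise_def tables_def a_def c_def x_def charge_def)
  have "prog_runs 7 50 R M 50 (\<lambda>R' M'. fixed_regs R' \<and> R' 12 = Suc a \<and> R' 16 = Suc (Suc i) \<and>
      R' 15 = x - (c + k) \<and> M' = M)"
    using facts bounds unfolding fixed_regs_def
    by - (rule runs_step, simp, simp add: threshold_program_def, simp,
        (rule runs_step_to, (simp; fail), simp add: threshold_program_def, simp)+,
        rule runs_done, simp)
  then show ?thesis
    by (rule runs_mono) (use inv in \<open>auto simp: inv_raise_def charge_def a_def x_def c_def\<close>)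
qed

lemma run_raise_exit:
  assumes inv: "inv_raise threshold R M"
  shows "prog_runs 6 50 R M 67 (inv_select 0)"
proof -
  define x where "x = list_touching S es - charge threshold"
  define c where "c = count_above n S es threshold"
  have facts: "fixed_regs R" "R 16 = Suc threshold" "R 15 = x" "M (R 12) = c" "c \<le> n" "k \<le> n" "x < c + k"
    using inv count_above_le[of n S es threshold] k_bounds threshold_less charge_threshold_le
    by (auto simp: inv_raise_def tables_def c_def x_def charge_def)
  have "prog_runs 6 50 R M 67 (\<lambda>R' M'. fixed_regs R' \<and> R' 9 = 2 \<and> R' 13 = 2 * m + 3 + k \<and>
      R' 16 = Suc threshold \<and> M' = M)"
    using facts bounds base_def unfolding fixed_regs_def
    by - ((rule runs_step_to, (simp; fail), simp add: threshold_program_def, simp)+,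
        rule runs_done, simp)
  then show ?thesis
    by (rule runs_mono) (use inv in \<open>auto simp: inv_raise_def inv_select_def selected_def tables_def
      base_def mem0_props(5)\<close>)
qed

lemma length_selected: "length (selected i) \<le> k + i"
  using length_filter_le[of "\<lambda>v. threshold < list_cross_degree S es v" "take i (endpoints es)"]
  by (simp add: selected_def)

lemma run_select_step:
  assumes i: "i < 2 * m" and inv: "inv_select i R M"
  shows "prog_runs 8 67 R M 67 (inv_select (Suc i))"
proof -
  define a where "a = 2 + i"
  define z where "z = 2 * m + 2"
  define v where "v = endpoints es ! i"
  define out where "out = 2 * m + 3 + length (selected i)"
  define d where "d = list_cross_degree S es v"
  have v: "v < n" using endpoints_less i by (simp add: v_def)
  have a: "a < z" "z < out" "out < base"
    using i length_selected[of i] by (auto simp: a_def z_def out_def base_def)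
  have facts: "fixed_regs R" "R 9 = a" "R 10 = z" "R 13 = out" "R 16 = Suc threshold" "M a = v"
      "M (base + n + v) = d"
    using inv v i mem0_props(3)[OF i]
    by (auto simp: inv_select_def a_def z_def v_def out_def d_def fixed_regs_def)
  have sel: "selected (Suc i) = selected i @ (if threshold < d then [v] else [])"
    using i by (simp add: selected_def take_Suc_conv_app_nth v_def d_def)
  show ?thesis
  proof (cases "threshold < d")
    case True
    then have "prog_runs 8 67 R M 67 (\<lambda>R' M'. fixed_regs R' \<and> R' 9 = Suc a \<and> R' 13 = Suc out \<and>
        R' 16 = Suc threshold \<and> M' = M(out := v))"
      using facts a v bounds unfolding fixed_regs_def
      by - (rule runs_step, simp, simp add: threshold_program_def, simp,
          (rule runs_step_to, (simp; fail), simp add: threshold_program_def, simp)+,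
          rule runs_done, simp)
    then show ?thesis
      by (rule runs_mono) (use True inv sel a in \<open>auto simp: inv_select_def a_def out_def z_def nth_append less_Suc_eq\<close>)
  next
    case False
    then have "prog_runs 8 67 R M 67 (\<lambda>R' M'. fixed_regs R' \<and> R' 9 = Suc a \<and> R' 13 = out \<and>
        R' 16 = Suc threshold \<and> M' = M)"
      using facts a v bounds unfolding fixed_regs_def
      by - (rule runs_step, simp, simp add: threshold_program_def, simp,
          (rule runs_step_to, (simp; fail), simp add: threshold_program_def, simp)+,
          rule runs_done, simp)
    then show ?thesis
      by (rule runs_mono) (use False inv sel in \<open>auto simp: inv_select_def a_def out_def\<close>)
  qed
qed

definition final :: "(nat \<Rightarrow> nat) \<Rightarrow> (nat \<Rightarrow> nat) \<Rightarrow> bool" where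
  "final R M \<longleftrightarrow> map (\<lambda>i. M (R 0 + i)) [0..<R 1] = selected (2 * m)"

lemma run_select_exit:
  assumes inv: "inv_select (2 * m) R M"
  shows "prog_runs 2 67 R M 69 final"
proof -
  define l where "l = length (selected (2 * m))"
  have facts: "fixed_regs R" "R 9 = 2 * m + 2" "R 13 = R 0 + l" "l < base"
    using inv length_selected[of "2 * m"] by (auto simp: inv_select_def fixed_regs_def l_def base_def)
  have "prog_runs 2 67 R M 69 (\<lambda>R' M'. R' 0 = 2 * m + 3 \<and> R' 1 = l \<and> M' = M)"
    using facts bounds unfolding fixed_regs_def
    by - ((rule runs_step_to, (simp; fail), simp add: threshold_program_def, simp)+,
        rule runs_done, simp)
  then show ?thesis
    by (rule runs_mono) (use inv in \<open>auto simp: inv_select_def final_def l_def intro: nth_equalityI\<close>)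
qed

lemma run_program:
  assumes "k \<le> 4 * m"
  shows "prog_runs (67 * m + 31) 0 (\<lambda>_. 0) mem0 69 final"
proof -
  \<comment> \<open>Setup, then four loops, each followed by its exit segment. With
    \<open>k \<le> 4 * m\<close> and \<open>threshold \<le> m\<close> the loops cost at most
    \<open>(20 + 24 + 7 + 16) * m\<close>; the rest adds up to 31.\<close>
  have "prog_runs (17 + (k * 5 + (3 + (m * 24 + (3 + (threshold * 7 + (6 + (2 * m * 8 + 2))))))))
      0 (\<lambda>_. 0) mem0 69 final"
    by (rule runs_trans run_setup runs_loop[where I = inv_mark] run_mark_step run_mark_exit
      runs_loop[where I = inv_scan] run_scan_step run_scan_exit
      runs_loop[where I = inv_raise] run_raise_step run_raise_exit
      runs_loop[where I = inv_select] run_select_step run_select_exit | assumption)+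
  then show ?thesis
    by (rule runs_mono) (use assms threshold_le in auto)
qed

end

subsection \<open>Correctness\<close>

text \<open>The unordered pairs are distinct, so list positions correspond one-to-one to
  edges.\<close>

lemma length_filter_lists_edges:
  assumes "lists_edges es E"
  shows "length (filter (\<lambda>(u, w). Q {u, w}) es) = card {e \<in> E. Q e}"
proof -
  let ?f = "\<lambda>(u, w). {u, w}"
  have "length (filter (\<lambda>(u, w). Q {u, w}) es) = length (filter Q (map ?f es))"
    by (simp add: filter_map comp_def case_prod_unfold)
  also have "\<dots> = card (set (filter Q (map ?f es)))"
    using assms by (intro distinct_card[symmetric] distinct_filter) (simp add: lists_edges_def Let_def)
  also have "set (filter Q (map ?f es)) = {e \<in> E. Q e}"
    using assms by (auto simp: lists_edges_def Let_def)
  finally show ?thesis .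
qed

lemma list_cross_degree_eq:
  assumes "lists_edges es E" "v \<notin> S"
  shows "list_cross_degree S es v = cross_degree E S v"
proof -
  have "filter (\<lambda>(u, w). u = v \<and> w \<in> S \<or> w = v \<and> u \<in> S) es =
      filter (\<lambda>(u, w). v \<in> {u, w} \<and> {u, w} \<inter> S \<noteq> {}) es"
    using assms(2) by (intro filter_cong) auto
  then show ?thesis
    using length_filter_lists_edges[OF assms(1), of "\<lambda>e. v \<in> e \<and> e \<inter> S \<noteq> {}"] assms(2)
    by (simp add: list_cross_degree_def cross_degree_def)
qed

lemma list_touching_eq:
  assumes "lists_edges es E"
  shows "list_touching S es = card {e \<in> E. e \<inter> S \<noteq> {}}"
proof -
  have "filter (\<lambda>(u, w). u \<in> S \<or> w \<in> S) es = filter (\<lambda>(u, w). {u, w} \<inter> S \<noteq> {}) es"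
    by (intro filter_cong) auto
  then show ?thesis
    using length_filter_lists_edges[OF assms, of "\<lambda>e. e \<inter> S \<noteq> {}"]
    by (simp add: list_touching_def)
qed

lemma count_above_eq:
  assumes "lists_edges es E"
  shows "count_above n S es j = card {v \<in> {..<n} - S. j < cross_degree E S v}"
proof -
  have "{v. v < n \<and> j < list_cross_degree S es v} = {v \<in> {..<n} - S. j < cross_degree E S v}"
    using list_cross_degree_eq[OF assms] by (auto simp: list_cross_degree_def split: if_splits)
  then show ?thesis by (simp add: count_above_def)
qed

text \<open>A vertex of positive degree occurs among the endpoints, so scanning the edge list,
  rather than all \<open>n\<close> vertices, finds everything above the threshold.\<close>

lemma (in threshold_run) set_selected:
  assumes "lists_edges es E"
  shows "set (selected (2 * m)) = S \<union> {v \<in> {..<n} - S. threshold < cross_degree E S v}"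
proof -
  have deg: "list_cross_degree S es v = (if v \<in> S then 0 else cross_degree E S v)" for v
    using list_cross_degree_eq[OF assms] by (simp add: list_cross_degree_def)
  have "v \<in> set (endpoints es)" if "0 < list_cross_degree S es v" for v
  proof -
    have "filter (\<lambda>(u, w). u = v \<and> w \<in> S \<or> w = v \<and> u \<in> S) es \<noteq> []"
      using that by (auto simp: list_cross_degree_def split: if_splits)
    then obtain u w where "(u, w) \<in> set es" "v = u \<or> v = w"
      by (auto simp: filter_empty_conv)
    then show ?thesis by (force simp: endpoints_def)
  qed
  moreover have "set (endpoints es) \<subseteq> {..<n}" using edges by (auto simp: endpoints_def)
  ultimately have "{v \<in> set (endpoints es). threshold < list_cross_degree S es v} =
      {v \<in> {..<n}. threshold < list_cross_degree S es v}"
    by (auto intro: le_less_trans[of 0])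
  also have "\<dots> = {v \<in> {..<n} - S. threshold < cross_degree E S v}"
    by (auto simp: deg split: if_splits)
  finally show ?thesis by (simp add: selected_def)
qed

text \<open>The output is the single word at address 1: the edge count 0, read as the vertex
  0.\<close>

lemma run_program_no_edges:
  assumes "M 1 = 0" "1 < B"
  shows "runs threshold_program B 6 0 (\<lambda>_. 0) M 69 (\<lambda>R M'. R 0 = 1 \<and> R 1 = 1 \<and> M' = M)"
  using assms
  by - ((rule runs_step_to, (simp; fail), simp add: threshold_program_def, simp)+,
      rule runs_done, simp)

lemma words_below_initial:
  assumes "set (encode_input n es vs) \<subseteq> {..<B}" "0 < B"
  shows "words_below B (initial_state (encode_input n es vs) \<epsilon>)"
  using assms nth_mem unfolding words_below_def initial_state_def by fastforce

lemma threshold_program_correct: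
  assumes G: "graph {..<n} E" and H: "densest_subgraph {..<n} E H"
    and eps: "0 \<le> \<epsilon>" "\<epsilon> < 1" and S: "S \<subseteq> {..<n}"
    and cover: "real (card (S \<inter> H)) \<ge> (1 - \<epsilon>) * real (card H)"
    and extra: "real (card (S - H)) \<le> \<epsilon> * real (card H)"
    and Es: "lists_edges es E" and vs: "lists_set vs S"
    and B: "8 * (n + card E + 2) \<le> B"
  obtains s where
    "halts_within threshold_program B (67 * card E + 31) (initial_state (encode_input n es vs) \<epsilon>) s"
    "set (output_list s) \<subseteq> {..<n}" "set (output_list s) \<noteq> {}"
    "density E (set (output_list s)) \<ge> (1 - 3 * \<epsilon>) * density E H"
proof -
  let ?s = "initial_state (encode_input n es vs) \<epsilon>"
  have m: "length es = card E"
    using length_filter_lists_edges[OF Es, of "\<lambda>_. True"] by simp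
  have edges: "u < n \<and> v < n" if "(u, v) \<in> set es" for u v
  proof -
    have "{u, v} \<in> E" using Es that by (force simp: lists_edges_def Let_def)
    then show ?thesis using G by (auto simp: graph_def)
  qed
  have vs': "distinct vs" "set vs = S" using vs by (auto simp: lists_set_def)
  then have k: "length vs = card S" using distinct_card by metis
  then have "length vs \<le> n" using card_mono[OF _ S] by simp
  then have wb: "words_below B ?s"
    using B edges vs' S by (intro words_below_initial) (fastforce simp: encode_input_def m)+
  have HV: "H \<subseteq> {..<n}" "H \<noteq> {}" using H by (auto simp: densest_subgraph_def)
  then have fin: "finite H" "finite S" using S finite_subset by blast+
  then have "0 < card H" using HV by (simp add: card_gt_0_iff)
  then have "0 < (1 - \<epsilon>) * real (card H)" using eps by simp
  then have "S \<inter> H \<noteq> {}" using cover by fastforce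
  then have S0: "S \<noteq> {}" by auto
  show thesis
  proof (cases "E = {}")
    case True
    have init: "pc ?s = 0" "reg ?s = (\<lambda>_. 0)" by (simp_all add: initial_state_def)
    have mem1: "mem ?s 1 = 0" using m True by (simp add: initial_state_def encode_input_def)
    have "runs threshold_program B 6 (pc ?s) (reg ?s) (mem ?s) 69
        (\<lambda>R M'. R 0 = 1 \<and> R 1 = 1 \<and> M' = mem ?s)"
      using run_program_no_edges[of "mem ?s" B] mem1 B by (simp add: init)
    then have "runs threshold_program B (67 * card E + 31) (pc ?s) (reg ?s) (mem ?s) 69
        (\<lambda>R M'. R 0 = 1 \<and> R 1 = 1 \<and> M' = mem ?s)"
      by (rule runs_mono) auto
    then obtain s where s: "halts_within threshold_program B (67 * card E + 31) ?s s"
        "reg s 0 = 1 \<and> reg s 1 = 1 \<and> mem s = mem ?s"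
      by (rule runs_halts_within[OF _ wb]) (auto simp: threshold_program_def)
    have "set (output_list s) = {0}"
      using s(2) mem1 by (simp add: output_list_def)
    then show thesis
      using HV True by (intro that[OF s(1)]) (auto simp: density_def edges_within_def)
  next
    case False
    have "card E \<noteq> 0" using False graph_finite_edges[OF G] by simp
    then interpret threshold_run n es vs B
      using edges vs' S S0 B m by unfold_locales auto
    \<comment> \<open>\<open>S\<close> has at most \<open>card H\<close> elements inside
      \<open>H\<close> and at most as many outside, and \<open>card H\<close> is at most twice the
      number of edges.\<close>
    have "card S = card (S \<inter> H) + card (S - H)"
      using card_Un_disjoint[of "S \<inter> H" "S - H"] fin by (auto simp: Int_Diff_Un)
    moreover have "card (S \<inter> H) \<le> card H" using fin by (simp add: card_mono)
    moreover have "\<epsilon> * real (card H) \<le> real (card H)"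
      using eps by (simp add: mult_left_le_one_le)
    then have "card (S - H) \<le> card H" using extra by linarith
    ultimately have k4: "length vs \<le> 4 * length es"
      using card_densest_subgraph_le[OF G H False] k m by linarith
    have "runs threshold_program B (67 * card E + 31) (pc ?s) (reg ?s) (mem ?s) 69 final"
      using run_program[OF k4] unfolding m initial_state_def mem0_def[abs_def] by simp
    then obtain s where s: "halts_within threshold_program B (67 * card E + 31) ?s s"
        "final (reg s) (mem s)"
      by (rule runs_halts_within[OF _ wb]) (auto simp: threshold_program_def)
    have T: "set (output_list s) = S \<union> {v \<in> {..<n} - S. threshold < cross_degree E S v}"
      using s(2) set_selected[OF Es] vs'(2) by (simp add: final_def output_list_def)
    \<comment> \<open>The two inequalities satisfied by the threshold, rewritten from list counts to
      cardinalities, are the hypotheses \<open>le\<close> and \<open>less\<close>.\<close>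
    have "density E (set (output_list s)) \<ge> (1 - 3 * \<epsilon>) * density E H"
      by (rule threshold_density[OF G H S eps cover extra _ _ T])
        (use charge_threshold_le threshold_less in
          \<open>simp_all only: charge_def count_above_eq[OF Es] list_touching_eq[OF Es] vs'(2) k\<close>)
    then show thesis using that[OF s(1)] T S S0 by auto
  qed
qed

theorem theorem1:
  shows "\<exists>(P :: program) (t :: nat \<Rightarrow> nat) (c :: nat).
    (\<lambda>m. real (t m)) \<in> O(\<lambda>m. real m) \<and>
    (\<forall>(n :: nat) (m :: nat) (E :: nat set set) (H :: nat set) (S :: nat set) (\<epsilon> :: real)
      (es :: (nat \<times> nat) list) (vs :: nat list).
        graph {..<n} E \<and> card E = m \<and>
        densest_subgraph {..<n} E H \<and>
        0 \<le> \<epsilon> \<and> \<epsilon> < 1 \<and>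
        S \<subseteq> {..<n} \<and>
        real (card (S \<inter> H)) \<ge> (1 - \<epsilon>) * real (card H) \<and>
        real (card (S - H)) \<le> \<epsilon> * real (card H) \<and>
        lists_edges es E \<and> lists_set vs S
        \<longrightarrow>
        (\<exists>s. halts_within P ((n + m + 2) ^ c) (t m) (initial_state (encode_input n es vs) \<epsilon>) s \<and>
             (let T = set (output_list s)
              in T \<subseteq> {..<n} \<and> T \<noteq> {} \<and> density E T \<ge> (1 - 3 * \<epsilon>) * density E H)))"
proof (rule exI[of _ threshold_program], rule exI[of _ "\<lambda>m. 67 * m + 31"], rule exI[of _ 4],
    intro conjI allI impI)
  show "(\<lambda>m. real (67 * m + 31)) \<in> O(\<lambda>m. real m)"
    \<comment> \<open>\<open>98 = 67 + 31\<close> absorbs the constant term once \<open>m\<close> is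
      at least 1.\<close>
    by (rule bigoI[of _ 98]) (auto intro: eventually_mono[OF eventually_ge_at_top[of 1]])
next
  fix n m E H S \<epsilon> es vs
  assume *: "graph {..<n} E \<and> card E = m \<and> densest_subgraph {..<n} E H \<and> 0 \<le> \<epsilon> \<and> \<epsilon> < 1 \<and>
    S \<subseteq> {..<n} \<and> real (card (S \<inter> H)) \<ge> (1 - \<epsilon>) * real (card H) \<and>
    real (card (S - H)) \<le> \<epsilon> * real (card H) \<and> lists_edges es E \<and> lists_set vs S"
  \<comment> \<open>\<open>8 = 2 ^ 3 \<le> (n + m + 2) ^ 3\<close>, which is where the exponent 4
    comes from.\<close>
  have "8 * (n + m + 2) \<le> (n + m + 2) ^ 3 * (n + m + 2)"
    using power_mono[of 2 "n + m + 2" 3] by (intro mult_right_mono) auto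
  then have "8 * (n + card E + 2) \<le> (n + m + 2) ^ 4"
    using * by (simp add: eval_nat_numeral mult_ac)
  with * show "\<exists>s. halts_within threshold_program ((n + m + 2) ^ 4) (67 * m + 31)
      (initial_state (encode_input n es vs) \<epsilon>) s \<and>
      (let T = set (output_list s)
       in T \<subseteq> {..<n} \<and> T \<noteq> {} \<and> density E T \<ge> (1 - 3 * \<epsilon>) * density E H)"
    by (metis threshold_program_correct)
qed

end
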